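(* For $n\geq 1$, the interval $F_n$ of $(\mathscr{D}_{n+2},\leq)$ is mapped by $\rho$ to the set $Z_n\subseteq\{0,1,2\}^n$ of coordinates of (the vertices of) the Hochschild polytope of Saneblidze; that is, the image of $F_n$ by $\rho$ is $\rho(F_n)=Z_n$.
   Context: A Dyck path of size $n\geq 0$ is a word of length $2n$ in the letters $0,1$ with $n$ letters $1$ and $n$ letters $0$ such that every prefix contains at least as many $1$'s as $0$'s (the height after a prefix is its number of $1$'s minus its number of $0$'s). Let $\mathscr{D}_n$ be the set of Dyck paths of size $n$. A subpath of a Dyck path $w$ is a non-empty sequence $x$ of consecutive letters of $w$ that starts and ends at the same height and stays strictly above that height in between. A subpath $x$ is movable in $w$ if it is immediately preceded in $w$ by the letter $0$ and either $x$ ends at the last letter of $w$ or $x$ is immediately followed in $w$ by the letter $1$. For a movable subpath $x$, let $N=N(w,x)\geq 1$ be the number of consecutive letters $0$ just before $x$, so $w=a\,0^{N}\,x\,b$ where $a$ does not end with $0$; for $1\leq i\leq N$ let $M(w,x,i)=a\,0^{N-i}\,x\,0^{i}\,b\in\mathscr{D}_n$. Let $\Gamma_n$ be the directed graph on $\mathscr{D}_n$ with edges $w\to M(w,x,i)$ for all movable $x$ in $w$ and all $1\leq i\leq N(w,x)$. The dexter order is: $u\leq v$ if and only if there is a directed path (possibly of length $0$) from $u$ to $v$ in $\Gamma_n$. This is a partial order whose cover relations are exactly the edges of $\Gamma_n$. The interval $F_n$: for $n\geq 1$, $F_n$ is the interval in $\mathscr{D}_{n+2}$ between $(1,1,0,0,(1,0)^n)$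 and $(1,1^n,0^n,1,0,0)$ (these two elements are comparable). The map $\rho$: a valley of a Dyck path is an occurrence of consecutive letters $(0,1)$, and its height is the height at the point between these two letters. All elements of $F_n$ start with $(1,1)$ and all their valleys have height $0$ or $1$. For $w\in F_n$, the word $\rho(w)$ in the alphabet $\{0,1,2\}$ is defined by reading $w$ from left to right, keeping an integer $N_2$ (initially $0$) and a current word (initially empty). Each time two consecutive letters $1,1$ are read (overlapping pairs allowed, but excluding the pair formed by the first two letters of $w$), $N_2$ is increased by $1$. Each time a valley of height $h$ is read, the word $[h,2,\dots,2]$ with $N_2$ letters $2$ is appended to the current word, and $N_2$ is reset to $0$. The final current word is $\rho(w)$; it has length $n$. The set $Z_n$: define recursively sets $Z_{n,0},Z_{n,1},Z_{n,b}\subseteq\{0,1,2\}^n$ with $Z_{n,b}\subseteq Z_{n,1}$ by $Z_{1,0}=\{[0]\}$, $Z_{1,1}=Z_{1,b}=\{[1]\}$ and, for $n\geq 1$: (i) $Z_{n+1,1}$ consists of all $[z,0]$ and $[z,2]$ with $z\in Z_{n,1}$ and all $[z,1]$ with $z\in Z_{n,b}$; (ii) $Z_{n+1,b}$ consists of all $[z,1]$ and $[z,2]$ with $z\in Z_{n,b}$; (iii) $Z_{n+1,0}$ consists of the words obtained by replacing the first letter by $0$ in those elements of $Z_{n+1,1}$ in which the letter $1$ appears only as the first letter. Then $Z_n=Z_{n,0}\sqcup Z_{n,1}$ is the set of coordinates of the vertices of the Hochschild polytope of Saneblidze. *)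

theory Defs
  imports Main
begin

definition height :: "nat list \<Rightarrow> int" where
  "height w = int (count_list w 1) - int (count_list w 0)"

definition dyck_paths :: "nat \<Rightarrow> nat list set" where
  "dyck_paths n = {w. length w = 2 * n \<and> set w \<subseteq> {0, 1} \<and>
     count_list w 1 = n \<and> count_list w 0 = n \<and>
     (\<forall>k \<le> length w. height (take k w) \<ge> 0)}"

text \<open>Whether an occurrence of \<open>x\<close> in a Dyck path is a subpath depends only on the word \<open>x\<close>,
  since only heights relative to the starting point of \<open>x\<close> matter.  The occurrence itself is
  recorded by the factorization of the Dyck path around \<open>x\<close>.\<close>

definition is_subpath :: "nat list \<Rightarrow> bool" where
  "is_subpath x \<longleftrightarrow> x \<noteq> [] \<and> height x = 0 \<and>
     (\<forall>k. 0 < k \<and> k < length x \<longrightarrow> height (take k x) > 0)"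

text \<open>The occurrence of \<open>x\<close> in \<open>w = a 0\<^sup>N x b\<close> that starts after \<open>a 0\<^sup>N\<close> is movable, and
  \<open>N = N(w,x)\<close>.\<close>

definition movable :: "nat list \<Rightarrow> nat list \<Rightarrow> nat \<Rightarrow> nat list \<Rightarrow> nat list \<Rightarrow> bool" where
  "movable w a N x b \<longleftrightarrow>
     w = a @ replicate N 0 @ x @ b \<and> N \<ge> 1 \<and> (a = [] \<or> last a \<noteq> 0) \<and>
     is_subpath x \<and> (b = [] \<or> hd b = 1)"

definition dexter_edges :: "nat \<Rightarrow> (nat list \<times> nat list) set" where
  "dexter_edges n = {(w, a @ replicate (N - i) 0 @ x @ replicate i 0 @ b) | w a N x b i.
     w \<in> dyck_paths n \<and> movable w a N x b \<and> 1 \<le> i \<and> i \<le> N}"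

definition dexter_le :: "nat \<Rightarrow> nat list \<Rightarrow> nat list \<Rightarrow> bool" where
  "dexter_le n u v \<longleftrightarrow> u \<in> dyck_paths n \<and> v \<in> dyck_paths n \<and> (u, v) \<in> (dexter_edges n)\<^sup>*"

definition F :: "nat \<Rightarrow> nat list set" where
  "F n = {w. dexter_le (n + 2) ([1, 1, 0, 0] @ concat (replicate n [1, 0])) w \<and>
             dexter_le (n + 2) w ([1] @ replicate n 1 @ replicate n 0 @ [1, 0, 0])}"

text \<open>Reading the letters at positions \<open>i\<close> and \<open>i + 1\<close> (counted from 0); the state is the
  counter \<open>N\<^sub>2\<close> together with the current word.  The conversion \<open>nat\<close> is harmless, as the heights
  in a Dyck path are non-negative.\<close>

definition rho_step :: "nat list \<Rightarrow> nat \<Rightarrow> nat \<times> nat list \<Rightarrow> nat \<times> nat list" where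
  "rho_step w i = (\<lambda>(N2, cur).
     if w ! i = 1 \<and> w ! (i + 1) = 1 then (N2 + 1, cur)
     else if w ! i = 0 \<and> w ! (i + 1) = 1
       then (0, cur @ [nat (height (take (i + 1) w))] @ replicate N2 2)
     else (N2, cur))"

text \<open>The positions start at 1 because the pair formed by the first two letters is excluded: it is
  not counted in \<open>N\<^sub>2\<close>, and being \<open>(1,1)\<close> on \<open>F n\<close> it is not a valley.\<close>

definition rho :: "nat list \<Rightarrow> nat list" where
  "rho w = snd (fold (rho_step w) [1..<length w - 1] (0, []))"

text \<open>The sets below are meant for positive indices only; the value at index 0 is a dummy.\<close>

fun Zb :: "nat \<Rightarrow> nat list set" where
  "Zb 0 = {}"
| "Zb (Suc 0) = {[1]}"
| "Zb (Suc (Suc n)) = {z @ [1] | z. z \<in> Zb (Suc n)} \<union> {z @ [2] | z. z \<in> Zb (Suc n)}"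

fun Z1 :: "nat \<Rightarrow> nat list set" where
  "Z1 0 = {}"
| "Z1 (Suc 0) = {[1]}"
| "Z1 (Suc (Suc n)) = {z @ [0] | z. z \<in> Z1 (Suc n)} \<union> {z @ [2] | z. z \<in> Z1 (Suc n)} \<union>
     {z @ [1] | z. z \<in> Zb (Suc n)}"

fun Z0 :: "nat \<Rightarrow> nat list set" where
  "Z0 0 = {}"
| "Z0 (Suc 0) = {[0]}"
| "Z0 (Suc (Suc n)) = {0 # t | t. 1 # t \<in> Z1 (Suc (Suc n)) \<and> 1 \<notin> set t}"

definition Z :: "nat \<Rightarrow> nat list set" where
  "Z n = Z0 n \<union> Z1 n"

lemma Zb_subset_Z1: "Zb n \<subseteq> Z1 n"
  by (induction n rule: Zb.induct) auto

lemma Z1_hd: "z \<in> Z1 n \<Longrightarrow> z \<noteq> [] \<and> hd z = 1"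
proof (induction n arbitrary: z rule: Z1.induct)
  case (3 n)
  then show ?case using Zb_subset_Z1[of "Suc n"] by auto
qed auto

lemma Z0_Z1_disjoint: "Z0 n \<inter> Z1 n = {}"
proof -
  have "hd z = 0" if "z \<in> Z0 n" for z
    using that by (cases n rule: Z0.cases) auto
  then show ?thesis using Z1_hd by fastforce
qed

lemma Z1_words: "z \<in> Z1 n \<Longrightarrow> length z = n \<and> set z \<subseteq> {0, 1, 2}"
proof (induction n arbitrary: z rule: Z1.induct)
  case (3 n)
  then obtain y c where y: "z = y @ [c]" "c \<in> {0, 1, 2}" "y \<in> Z1 (Suc n)"
    using Zb_subset_Z1[of "Suc n"] by auto
  have "length y = Suc n" "set y \<subseteq> {0, 1, 2}"
    using "3.IH" y(3) by blast+
  then show ?case using y by simp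
qed auto

lemma Z_words: "Z n \<subseteq> {z. length z = n \<and> set z \<subseteq> {0, 1, 2}}"
proof -
  have "length z = n \<and> set z \<subseteq> {0, 1, 2}" if "z \<in> Z0 n" for z
  proof (cases n rule: Z0.cases)
    case (3 m)
    with that obtain t where t: "z = 0 # t" "1 # t \<in> Z1 n" by auto
    show ?thesis using Z1_words[OF t(2)] t(1) by simp
  qed (use that in auto)
  then show ?thesis using Z1_words[of _ n] unfolding Z_def by blast
qed

end

theory Submission
  imports Defs
begin

text \<open>A word whose valleys have weakly decreasing heights in \<open>{0, 1}\<close> and whose last run of ones
  has length 1 is determined by the list of its blocks \<open>(h, m)\<close>, one for each valley, where \<open>h\<close> is
  the height of the valley and \<open>m\<close> counts the twos that \<open>\<rho>\<close> writes after \<open>h\<close>.  Such block lists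
  also encode \<open>Z\<^sub>n\<close>, which consists of the words over \<open>{0, 1, 2}\<close> that do not start
  with 2 and in which no 1 comes after a 0.

  If the target of an edge of the dexter order satisfies the condition on the valleys, then the
  valleys of the moved subpath would be too high, so it has none, and the source
  satisfies the condition too.  Hence all elements of \<open>F\<^sub>n\<close> are given by block lists.
  Conversely, there are edges that merge consecutive blocks \<open>(h, m), (h, m')\<close> into
  \<open>(h, m + m' + 1)\<close>, and edges that turn the first block \<open>(0, m)\<close> into \<open>(1, m)\<close>.  These suffice to
  reach every block list from \<open>(0, 0)\<^sup>n\<close>, and \<open>(1, n - 1)\<close> from every block list.\<close>

section \<open>Heights, the prefix condition and valleys of words\<close>

lemma height_simps [simp]:
  "height [] = 0"
  "height (c # s) = (if c = 1 then 1 else if c = 0 then -1 else 0) + height s"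
  "height (s @ t) = height s + height t"
  "height (replicate k 0) = - int k"
  "height (replicate k (Suc 0)) = int k"
  by (auto simp: height_def) (induction k; auto)+

text \<open>The prefix condition with a variable starting height, so that it splits over
  concatenations.\<close>

fun nonneg_from :: "int \<Rightarrow> nat list \<Rightarrow> bool" where
  "nonneg_from h [] \<longleftrightarrow> 0 \<le> h"
| "nonneg_from h (c # s) \<longleftrightarrow> 0 \<le> h \<and> nonneg_from (h + height [c]) s"

lemma nonneg_from_start: "nonneg_from h s \<Longrightarrow> 0 \<le> h"
  by (cases s) auto

lemma nonneg_from_iff: "nonneg_from h s \<longleftrightarrow> (\<forall>k \<le> length s. 0 \<le> h + height (take k s))"
proof (induction s arbitrary: h)
  case (Cons c s)
  have "(\<forall>k \<le> Suc m. P k) \<longleftrightarrow> P 0 \<and> (\<forall>k \<le> m. P (Suc k))" for P m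
    by (metis Suc_le_mono le0 not0_implies_Suc)
  then show ?case using Cons.IH[of "h + height [c]"] by (simp add: add.assoc)
qed simp

lemma nonneg_from_append:
  "nonneg_from h (s @ t) \<longleftrightarrow> nonneg_from h s \<and> nonneg_from (h + height s) t"
  by (induction s arbitrary: h) (auto simp: add.assoc dest: nonneg_from_start)

lemma nonneg_from_replicate [simp]:
  "nonneg_from h (replicate k 0) \<longleftrightarrow> int k \<le> h"
  "nonneg_from h (replicate k (Suc 0)) \<longleftrightarrow> 0 \<le> h"
  by (induction k arbitrary: h) auto

lemma length_eq_counts:
  "set w \<subseteq> {0, 1} \<Longrightarrow> length w = count_list w (0::nat) + count_list w 1"
  by (induction w) auto

lemma dyck_paths_iff:
  "w \<in> dyck_paths n \<longleftrightarrow> set w \<subseteq> {0, 1} \<and> count_list w 1 = n \<and> height w = 0 \<and> nonneg_from 0 w"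
  using length_eq_counts[of w] by (auto simp: dyck_paths_def nonneg_from_iff height_def)

fun valleys :: "int \<Rightarrow> nat list \<Rightarrow> int list" where
  "valleys h [] = []"
| "valleys h (c # s) =
    (if c = 0 \<and> s \<noteq> [] \<and> hd s = 1 then [h - 1] else []) @ valleys (h + height [c]) s"

lemma valleys_append:
  "valleys h (s @ t) = valleys h s @
     (if s \<noteq> [] \<and> last s = 0 \<and> t \<noteq> [] \<and> hd t = 1 then [h + height s] else []) @
     valleys (h + height s) t"
proof (induction s arbitrary: h)
  case (Cons c s)
  show ?case by (cases "s = []") (simp_all add: Cons.IH add.assoc)
qed simp

lemma valleys_replicate [simp]: "valleys h (replicate k c) = []"
  by (induction k arbitrary: h) auto

lemma valleys_shift: "valleys h s = map ((+) h) (valleys 0 s)"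
proof (induction s arbitrary: h)
  case (Cons c s)
  show ?case
    using Cons.IH[of "h + height [c]"] Cons.IH[of "height [c]"] by (auto simp: add.assoc)
qed simp

lemma valley_interior:
  "y \<in> set (valleys h s) \<Longrightarrow> \<exists>k. 0 < k \<and> k < length s \<and> y = h + height (take k s)"
proof (induction s arbitrary: h)
  case (Cons c s)
  show ?case
  proof (cases "y \<in> set (valleys (h + height [c]) s)")
    case True
    then obtain k where "0 < k" "k < length s" "y = h + height [c] + height (take k s)"
      using Cons.IH by blast
    then show ?thesis by (intro exI[of _ "Suc k"]) auto
  next
    case False
    with Cons.prems have "c = 0" "s \<noteq> []" "y = h - 1" by (auto split: if_splits)
    then show ?thesis by (intro exI[of _ 1]) auto
  qed
qed simp

lemma valleys_nonneg: "nonneg_from h s \<Longrightarrow> y \<in> set (valleys h s) \<Longrightarrow> 0 \<le> y"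
  using valley_interior[of y h s] by (auto simp: nonneg_from_iff)

lemma no_valleys:
  assumes "set s \<subseteq> {0, 1}" "valleys h s = []"
  obtains m c where "s = replicate m 1 @ replicate c 0"
proof -
  have "\<exists>m c. s = replicate m 1 @ replicate c 0"
    using assms
  proof (induction s arbitrary: h)
    case (Cons d s)
    then obtain m c where s: "s = replicate m 1 @ replicate c 0"
      by (metis append_is_Nil_conv insert_subset list.set(2) valleys.simps(2))
    show ?case
    proof (cases "d = 1")
      case True
      then show ?thesis using s by (intro exI[of _ "Suc m"] exI[of _ c]) simp
    next
      case False
      with Cons.prems have d: "d = 0" "s = [] \<or> hd s \<noteq> 1" by (auto split: if_splits)
      with s have "m = 0" by (cases m) auto
      then show ?thesis using s d by (intro exI[of _ 0] exI[of _ "Suc c"]) simp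
    qed
  qed simp
  then show thesis using that by blast
qed

section \<open>Words whose last run of ones has length 1\<close>

definition last_run_single :: "nat list \<Rightarrow> bool" where
  "last_run_single w \<longleftrightarrow> (\<exists>p j. w = p @ 0 # 1 # replicate j 0)"

lemma last_one_unique:
  "p @ 1 # replicate j (0::nat) = q @ 1 # replicate k 0 \<Longrightarrow> p = q"
proof (induction j arbitrary: k)
  case 0
  then show ?case by (cases k) (auto simp: replicate_append_same[symmetric] simp flip: append_assoc append_Cons)
next
  case (Suc j)
  show ?case
  proof (cases k)
    case 0
    with Suc.prems show ?thesis
      by (auto simp: replicate_append_same[symmetric] simp flip: append_assoc append_Cons)
  next
    case (Suc k')
    with Suc.prems have "(p @ 1 # replicate j 0) @ [0] = (q @ 1 # replicate k' 0) @ [0]"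
      by (simp add: replicate_append_same)
    then show ?thesis using Suc.IH by simp
  qed
qed

text \<open>The last 1 of the word is the displayed 1 or comes later, so the final
  \<open>0 # 1 # replicate j 0\<close> lies inside \<open>0 # 1 # b\<close>.\<close>

lemma last_run_single_suffix:
  assumes "last_run_single (u @ 0 # 1 # b)"
  shows "last_run_single (0 # 1 # b)"
proof -
  obtain p j where "u @ 0 # 1 # b = p @ 0 # 1 # replicate j 0"
    using assms unfolding last_run_single_def by blast
  then consider us where "u = p @ us" "us @ 0 # 1 # b = 0 # 1 # replicate j 0"
    | us where "p = u @ us" "0 # 1 # b = us @ 0 # 1 # replicate j 0"
    by (auto simp: append_eq_append_conv2)
  then show ?thesis
  proof cases
    case 1
    have "us = []"
    proof (rule ccontr)
      assume "us \<noteq> []"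
      with 1 obtain vs where "us = 0 # vs" "vs @ 0 # 1 # b = 1 # replicate j 0" by (cases us) auto
      then obtain ws where "ws @ 0 # 1 # b = replicate j 0" by (cases vs) auto
      then have "1 \<in> set (replicate j (0::nat))"
        by (metis in_set_conv_decomp append_Cons append_assoc append_Nil)
      then show False by simp
    qed
    with 1 show ?thesis unfolding last_run_single_def by (metis append_Nil)
  qed (auto simp: last_run_single_def)
qed

text \<open>The last 1 of this run is the last 1 of the whole word, so its predecessor has to be 0;
  in a longer run it would be 1.\<close>

lemma last_run_single_run:
  assumes "last_run_single (u @ replicate m 1 @ replicate c 0)" "m \<ge> 1"
  shows "m = 1"
proof -
  obtain p j where "u @ replicate m 1 @ replicate c 0 = p @ 0 # 1 # replicate j 0"
    using assms(1) unfolding last_run_single_def by blast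
  moreover obtain m' where m: "m = Suc m'" using assms(2) by (cases m) auto
  ultimately have "(u @ replicate m' 1) @ 1 # replicate c 0 = (p @ [0]) @ 1 # replicate j 0"
    by (simp add: replicate_app_Cons_same)
  then have "u @ replicate m' 1 = p @ [0]" by (rule last_one_unique)
  then show ?thesis using m
    by (cases m') (auto simp flip: replicate_append_same simp flip: append_assoc)
qed

lemma last_run_single_appendI: "last_run_single b \<Longrightarrow> last_run_single (u @ b)"
  unfolding last_run_single_def by (metis append_assoc)

section \<open>Pulling regularity back along edges\<close>

lemma subpath_letters:
  assumes "is_subpath x" "set x \<subseteq> {0, 1}"
  shows "hd x = 1" "last x = 0"
proof -
  have len: "length x > 1"
  proof (rule ccontr)
    assume "\<not> length x > 1"
    moreover have "x \<noteq> []" using assms by (auto simp: is_subpath_def)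
    ultimately obtain c where "x = [c]" by (cases x) auto
    then show False using assms by (auto simp: is_subpath_def split: if_splits)
  qed
  then have "height (take 1 x) > 0" using assms(1) by (auto simp: is_subpath_def)
  then show "hd x = 1" using len by (cases x) (auto split: if_splits)
  have "height (butlast x) > 0" using assms(1) len by (auto simp: is_subpath_def butlast_conv_take)
  moreover have "height (butlast x @ [last x]) = 0" using assms(1) by (auto simp: is_subpath_def)
  ultimately show "last x = 0" by (auto split: if_splits)
qed

text \<open>The extra 1 in front bounds all valley heights by 1; the lower bound 0 comes from the
  Dyck condition.\<close>

definition regular :: "nat list \<Rightarrow> bool" where
  "regular w \<longleftrightarrow> sorted_wrt (\<ge>) (1 # valleys 0 w) \<and> last_run_single w"

text \<open>Once \<open>x\<close> is known to be a single peak, the valley lists of \<open>v\<close>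
  and \<open>w\<close> differ only in the valley just before \<open>x\<close>. In \<open>w\<close>
  it is as high as the end of \<open>x\<close>, so the heights still decrease weakly.\<close>

lemma regular_edge_source:
  assumes "(w, v) \<in> dexter_edges n" "regular v"
  shows "regular w"
proof -
  obtain a N x b i where w: "w \<in> dyck_paths n" and mov: "movable w a N x b"
    and i: "1 \<le> i" "i \<le> N" and v: "v = a @ replicate (N - i) 0 @ x @ replicate i 0 @ b"
    using assms(1) unfolding dexter_edges_def by blast
  have weq: "w = a @ replicate N 0 @ x @ b" and sub: "is_subpath x"
    and la: "a = [] \<or> last a \<noteq> 0" and hb: "b = [] \<or> hd b = 1"
    using mov by (auto simp: movable_def)
  have sets: "set a \<subseteq> {0, 1}" "set x \<subseteq> {0, 1}" "set b \<subseteq> {0, 1}"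
    using w weq by (auto simp: dyck_paths_iff)
  note hx = subpath_letters[OF sub sets(2)]
  have x0: "x \<noteq> []" "height x = 0" using sub by (auto simp: is_subpath_def)
  have nn: "nonneg_from 0 a" "int N \<le> height a"
    using w unfolding weq by (auto simp: dyck_paths_iff nonneg_from_append)
  have a0: "a \<noteq> []" using nn(2) i by auto
  obtain M where N: "N = M + i" using i by (metis le_iff_add add.commute)
  \<comment> \<open>\<open>a\<close> ends with 1, so for \<open>i = N\<close> there is no valley
    before \<open>x\<close> in \<open>v\<close>. The valley before \<open>b\<close> has the same
    height in both words.\<close>
  have valv: "valleys 0 v = valleys 0 a @ (if i < N then [height a - int (N - i)] else []) @
      valleys (height a - int (N - i)) x @ (if b = [] then [] else [height a - int N]) @
      valleys (height a - int N) b"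
    using i hx x0 a0 la hb unfolding v N by (auto simp: valleys_append diff_diff_eq)
  have valw: "valleys 0 w = valleys 0 a @ [height a - int N] @
      valleys (height a - int N) x @ (if b = [] then [] else [height a - int N]) @
      valleys (height a - int N) b"
    using i hx x0 a0 la hb unfolding weq by (auto simp: valleys_append)
  \<comment> \<open>In \<open>v\<close> the subpath starts at height at least \<open>i\<close>, so a
    valley inside it would have height at least 2.\<close>
  have "valleys (height a - int (N - i)) x = []"
  proof (rule ccontr)
    assume "valleys (height a - int (N - i)) x \<noteq> []"
    then obtain y where y: "y \<in> set (valleys (height a - int (N - i)) x)"
      using list.set_sel(1) by blast
    have "y \<le> 1" using assms(2) y valv by (auto simp: regular_def)
    moreover obtain k where "0 < k" "k < length x" "y = height a - int (N - i) + height (take k x)"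
      using valley_interior[OF y] by blast
    moreover from this sub have "height (take k x) > 0" by (auto simp: is_subpath_def)
    ultimately show False using i nn(2) by simp
  qed
  then have vx: "valleys h x = []" for h
    using valleys_shift[of "height a - int (N - i)" x] valleys_shift[of h x] by simp
  obtain m c where mc: "x = replicate m 1 @ replicate c 0"
    using no_valleys[OF sets(2) vx] by blast
  with x0 have "m = c" "m \<ge> 1" by auto
  show ?thesis
  proof (cases "b = []")
    case True
    \<comment> \<open>Here \<open>x\<close> ends the path, so the valley before it has height 0 in
      \<open>w\<close>, the least possible.\<close>
    have "height a = int N" using w x0 True unfolding weq by (simp add: dyck_paths_iff)
    then have "sorted_wrt (\<ge>) (1 # valleys 0 w)"
      using assms(2) True vx valv valw valleys_nonneg[OF nn(1)]
      by (auto simp: regular_def sorted_wrt_append)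
    \<comment> \<open>The ones of \<open>x\<close> are the last run of ones in \<open>v\<close>,
      which forces \<open>x\<close> to be 1 0.\<close>
    moreover have "last_run_single ((a @ replicate (N - i) 0) @ replicate m 1 @ replicate (c + i) 0)"
      using assms(2) True unfolding v mc regular_def by (simp add: replicate_add)
    from last_run_single_run[OF this \<open>m \<ge> 1\<close>] have "m = 1" .
    moreover obtain N' where "N = Suc N'" using i by (cases N) auto
    ultimately show ?thesis
      unfolding regular_def weq mc last_run_single_def using True \<open>m = c\<close>
      by (auto intro!: exI[of _ "a @ replicate N' 0"] exI[of _ 1] simp: replicate_app_Cons_same)
  next
    case False
    with hb obtain b' where b: "b = 1 # b'" by (cases b) auto
    \<comment> \<open>The height \<open>height a - int N\<close> already occurs in \<open>v\<close>
      as the valley before \<open>b\<close>; in \<open>w\<close> it occurs twice in a row.\<close>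
    have "sorted_wrt (\<ge>) (1 # valleys 0 w)"
      using assms(2) False vx valv valw by (auto simp: regular_def sorted_wrt_append)
    \<comment> \<open>In both words \<open>b\<close> is preceded by a 0, and the suffix from there
      on decides about the last run.\<close>
    moreover obtain i' where "i = Suc i'" using i by (cases i) auto
    then have "v = (a @ replicate (N - i) 0 @ x @ replicate i' 0) @ 0 # 1 # b'"
      unfolding v b by (simp add: replicate_app_Cons_same)
    then have "last_run_single (0 # 1 # b')"
      using assms(2) last_run_single_suffix unfolding regular_def by metis
    moreover have "w = (a @ replicate N 0 @ butlast x) @ 0 # 1 # b'"
      using append_butlast_last_id[OF x0(1)] hx(2) unfolding weq b by (metis append.assoc append_Cons append_Nil)
    ultimately show ?thesis
      unfolding regular_def using last_run_single_appendI by metis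
  qed
qed

section \<open>Block lists and their paths and words\<close>

text \<open>The part of the path after the letter 1 that follows a valley of height \<open>p\<close>.  The path starts
  with two ones, as if it had a valley of height 1 after its first letter.\<close>

fun blocks_tail :: "nat \<Rightarrow> (nat \<times> nat) list \<Rightarrow> nat list" where
  "blocks_tail p [] = replicate (p + 1) 0"
| "blocks_tail p ((h, m) # r) =
     replicate m 1 @ replicate (p + 1 + m - h) 0 @ 1 # blocks_tail h r"

definition path_of :: "(nat \<times> nat) list \<Rightarrow> nat list" where
  "path_of bl = 1 # 1 # blocks_tail 1 bl"

definition word_of :: "(nat \<times> nat) list \<Rightarrow> nat list" where
  "word_of bl = concat (map (\<lambda>(h, m). h # replicate m 2) bl)"

definition weight :: "(nat \<times> nat) list \<Rightarrow> nat" where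
  "weight bl = sum_list (map (\<lambda>(h, m). Suc m) bl)"

definition valid :: "(nat \<times> nat) list \<Rightarrow> bool" where
  "valid bl \<longleftrightarrow> sorted_wrt (\<ge>) (1 # map fst bl)"

lemma weight_simps [simp]:
  "weight [] = 0" "weight ((h, m) # r) = Suc m + weight r" "weight (s @ t) = weight s + weight t"
  by (auto simp: weight_def)

lemma word_of_simps [simp]:
  "word_of [] = []" "word_of ((h, m) # r) = h # replicate m 2 @ word_of r"
  "word_of (s @ t) = word_of s @ word_of t"
  by (auto simp: word_of_def)

lemma valid_le_1: "valid bl \<Longrightarrow> (h, m) \<in> set bl \<Longrightarrow> h \<le> 1"
  by (force simp: valid_def)

lemma count_list_replicate [simp]: "count_list (replicate k c) d = (if c = d then k else 0)"
  by (induction k) auto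

lemma blocks_tail_props:
  assumes "\<And>h m. (h, m) \<in> set bl \<Longrightarrow> h \<le> 1"
  shows "set (blocks_tail p bl) \<subseteq> {0, 1} \<and> count_list (blocks_tail p bl) 1 = weight bl \<and>
    int p + 1 + height (blocks_tail p bl) = 0 \<and> nonneg_from (int p + 1) (blocks_tail p bl)"
  using assms
proof (induction p bl rule: blocks_tail.induct)
  case (2 p h m r)
  have "h \<le> 1" using "2.prems" by auto
  \<comment> \<open>The bound on \<open>h\<close> makes the truncated subtraction exact.\<close>
  then have "int (p + 1 + m - h) = int p + 1 + int m - int h" by simp
  then show ?case using "2.IH" "2.prems" by (auto simp: nonneg_from_append algebra_simps)
qed auto

lemma path_of_dyck: "valid bl \<Longrightarrow> path_of bl \<in> dyck_paths (weight bl + 2)"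
  using blocks_tail_props[of bl 1] valid_le_1[of bl] by (auto simp: dyck_paths_iff path_of_def)

text \<open>\<open>blocks_tail\<close> without the final descent, so that cutting a block list cuts
  the path right after a letter 1.\<close>

fun blocks_head :: "nat \<Rightarrow> (nat \<times> nat) list \<Rightarrow> nat list" where
  "blocks_head p [] = []"
| "blocks_head p ((h, m) # r) =
     replicate m 1 @ replicate (p + 1 + m - h) 0 @ 1 # blocks_head h r"

lemma blocks_tail_append:
  "blocks_tail p (u @ v) = blocks_head p u @ blocks_tail (last (p # map fst u)) v"
  by (induction p u rule: blocks_head.induct) auto

lemma last_blocks_head: "blocks_head p u = [] \<or> last (blocks_head p u) = 1"
  by (induction p u rule: blocks_head.induct) auto

text \<open>The prefix \<open>a\<close> is the same for all \<open>v\<close>, so an edge that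
  changes only blocks after \<open>u\<close> can be checked locally. As \<open>a\<close> ends with
  1, zeros after it form a maximal run to the left, as \<open>movable\<close> requires.\<close>

lemma path_of_split:
  obtains a where "\<And>v. path_of (u @ v) = a @ blocks_tail (last (1 # map fst u)) v"
    "a \<noteq> []" "last a = 1"
proof
  show "path_of (u @ v) = (1 # 1 # blocks_head 1 u) @ blocks_tail (last (1 # map fst u)) v" for v
    by (simp add: path_of_def blocks_tail_append)
  show "last (1 # 1 # blocks_head 1 u) = 1" using last_blocks_head[of 1 u] by auto
qed simp

section \<open>Dexter edges between block lists\<close>

lemma is_subpath_peak: "is_subpath (replicate (Suc m) 1 @ replicate (Suc m) 0)"
  unfolding is_subpath_def
proof (intro conjI allI impI)
  fix k assume k: "0 < k \<and> k < length (replicate (Suc m) 1 @ replicate (Suc m) (0::nat))"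
  have "height (take k (replicate (Suc m) 1 @ replicate (Suc m) 0)) =
      int (min k (Suc m)) - int (min (k - Suc m) (Suc m))"
    by (simp only: take_append take_replicate height_simps One_nat_def length_replicate)
  then show "height (take k (replicate (Suc m) 1 @ replicate (Suc m) 0)) > 0"
    using k by auto
qed (auto simp: replicate.simps(2)[symmetric] simp del: replicate.simps height_simps(2))

lemma valid_ones_zeros:
  assumes "\<forall>x \<in> set u. fst x = 1" "\<forall>x \<in> set v. fst x = 0"
  shows "valid (u @ v)"
proof -
  have "sorted_wrt (\<ge>) (map fst v)" using assms(2) by (induction v) auto
  then have "sorted_wrt (\<ge>) (map fst (u @ v))"
    using assms by (induction u) (auto simp: image_iff)
  then show ?thesis using assms by (auto simp: valid_def)
qed

lemma dexter_edgeI: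
  assumes "w \<in> dyck_paths n" "w = a @ replicate N 0 @ replicate (Suc m) 1 @ replicate (Suc m) 0 @ b"
    "a \<noteq> []" "last a = 1" "b = [] \<or> hd b = 1" "1 \<le> i" "i \<le> N"
    "v = a @ replicate (N - i) 0 @ replicate (Suc m) 1 @ replicate (Suc m) 0 @ replicate i 0 @ b"
  shows "(w, v) \<in> dexter_edges n"
  unfolding dexter_edges_def movable_def using assms is_subpath_peak[of m]
  by (intro CollectI exI[of _ w] exI[of _ a] exI[of _ N]
      exI[of _ "replicate (Suc m) 1 @ replicate (Suc m) 0"] exI[of _ b] exI[of _ i]) simp

text \<open>Between the two valleys of height \<open>h\<close> lies a peak with
  \<open>Suc m'\<close> ones: the 1 after the first valley and the ones of the second block. Moving
  all zeros before this peak behind it removes the first valley and joins the \<open>m\<close> ones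
  to those of the peak.\<close>

lemma merge_edge:
  assumes "valid (u @ (h, m) # (h, m') # v)" "n = weight (u @ (h, m) # (h, m') # v) + 2"
  shows "(path_of (u @ (h, m) # (h, m') # v), path_of (u @ (h, m + Suc m') # v)) \<in> dexter_edges n"
proof -
  obtain a where a: "\<And>v. path_of (u @ v) = a @ blocks_tail (last (1 # map fst u)) v"
    "a \<noteq> []" "last a = 1" using path_of_split by blast
  define q where "q = last (1 # map fst u)"
  have "q \<in> set (1 # map fst u)" unfolding q_def by (rule last_in_set) simp
  then have q: "h \<le> q" using assms(1) by (auto simp: valid_def sorted_wrt_append)
  show ?thesis
  proof (rule dexter_edgeI[where a = "a @ replicate m 1" and m = m' and N = "q + 1 + m - h"
        and i = "q + 1 + m - h" and b = "1 # blocks_tail h v"])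
    show "path_of (u @ (h, m) # (h, m') # v) \<in> dyck_paths n"
      using assms path_of_dyck by blast
    show "path_of (u @ (h, m) # (h, m') # v) = (a @ replicate m 1) @ replicate (q + 1 + m - h) 0 @
        replicate (Suc m') 1 @ replicate (Suc m') 0 @ 1 # blocks_tail h v"
      unfolding a(1) q_def[symmetric] by simp
    have "q + 1 + (m + Suc m') - h = Suc m' + (q + 1 + m - h)" using q by simp
    note e = this
    show "path_of (u @ (h, m + Suc m') # v) = (a @ replicate m 1) @
        replicate (q + 1 + m - h - (q + 1 + m - h)) 0 @
        replicate (Suc m') 1 @ replicate (Suc m') 0 @ replicate (q + 1 + m - h) 0 @ 1 # blocks_tail h v"
      unfolding a(1) q_def[symmetric] blocks_tail.simps e replicate_add by simp
  qed (use q a in \<open>auto simp: last_append\<close>)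
qed

text \<open>Moving one zero across the peak after the valley of height 0 raises this valley to
  height 1. The peak returns to height 0, since the next block has height 0 or the path ends. As all
  blocks of \<open>u\<close> have height 1, the descent before the peak has \<open>2 + m\<close>
  zeros.\<close>

lemma raise_edge:
  assumes "\<forall>x \<in> set u. fst x = 1" "\<forall>x \<in> set v. fst x = 0"
    "n = weight (u @ (0, m) # v) + 2"
  shows "(path_of (u @ (0, m) # v), path_of (u @ (1, m) # v)) \<in> dexter_edges n"
proof -
  obtain a where a: "\<And>v. path_of (u @ v) = a @ blocks_tail (last (1 # map fst u)) v"
    "a \<noteq> []" "last a = 1" using path_of_split by blast
  have "last (1 # map fst u) \<in> set (1 # map fst u)" by (rule last_in_set) simp
  then have "last (1 # map fst u) = 1" using assms(1) by auto
  note a = a(1)[unfolded this] a(2,3)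
  have "valid (u @ (0, m) # v)" using assms by (intro valid_ones_zeros) auto
  then have dyck: "path_of (u @ (0, m) # v) \<in> dyck_paths n"
    using assms path_of_dyck by blast
  show ?thesis
  proof (cases v)
    case Nil
    \<comment> \<open>With no further block, the peak is the final 1 0 of the path.\<close>
    show ?thesis
      by (rule dexter_edgeI[where a = "a @ replicate m 1" and m = 0 and N = "2 + m"
        and i = 1 and b = "[]"]) (use dyck a(2,3) Nil in \<open>auto simp: a(1) last_append\<close>)
  next
    case (Cons y v')
    with assms(2) obtain m' where v: "v = (0, m') # v'" by (cases y) auto
    show ?thesis
      by (rule dexter_edgeI[where a = "a @ replicate m 1" and m = m' and N = "2 + m"
        and i = 1 and b = "1 # blocks_tail 0 v'"])
        (use dyck a(2,3) v in \<open>auto simp: a(1) last_append replicate_app_Cons_same\<close>)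
  qed
qed

text \<open>Blocks are raised from left to right, so that each step finds only height 1 before it
  and height 0 after it.\<close>

lemma raise_path:
  assumes "\<forall>x \<in> set u. fst x = 1" "\<forall>x \<in> set v. fst x = 0" "\<forall>x \<in> set v'. fst x = 0"
    "n = weight (u @ v @ v') + 2"
  shows "(path_of (u @ v @ v'), path_of (u @ map (\<lambda>(h, m). (1, m)) v @ v')) \<in> (dexter_edges n)\<^sup>*"
  using assms
proof (induction v arbitrary: u)
  case (Cons y v)
  then obtain m where y: "y = (0, m)" by (cases y) auto
  have "(path_of (u @ (0, m) # v @ v'), path_of (u @ (1, m) # v @ v')) \<in> dexter_edges n"
    by (rule raise_edge) (use Cons.prems y in auto)
  moreover have "(path_of ((u @ [(1, m)]) @ v @ v'),
      path_of ((u @ [(1, m)]) @ map (\<lambda>(h, m). (1, m)) v @ v')) \<in> (dexter_edges n)\<^sup>*"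
    by (rule Cons.IH) (use Cons.prems y in auto)
  ultimately show ?case using y by (simp add: converse_rtrancl_into_rtrancl)
qed simp

text \<open>The first block absorbs the blocks of \<open>v\<close> one at a time, and each
  contributes its weight.\<close>

lemma merge_path:
  assumes "valid (u @ (h, k) # v @ v')" "\<forall>x \<in> set v. fst x = h"
    "n = weight (u @ (h, k) # v @ v') + 2"
  shows "(path_of (u @ (h, k) # v @ v'), path_of (u @ (h, k + weight v) # v')) \<in> (dexter_edges n)\<^sup>*"
  using assms
proof (induction v arbitrary: k)
  case (Cons y v)
  then obtain m where y: "y = (h, m)" by (cases y) auto
  have "(path_of (u @ (h, k) # (h, m) # v @ v'), path_of (u @ (h, k + Suc m) # v @ v'))
      \<in> dexter_edges n"
    by (rule merge_edge) (use Cons.prems y in auto)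
  moreover have "(path_of (u @ (h, k + Suc m) # v @ v'), path_of (u @ (h, k + Suc m + weight v) # v'))
      \<in> (dexter_edges n)\<^sup>*"
    by (rule Cons.IH) (use Cons.prems y in \<open>auto simp: valid_def sorted_wrt_append\<close>)
  ultimately show ?case using y by (simp add: converse_rtrancl_into_rtrancl add.assoc)
qed simp

section \<open>Paths from the bottom and to the top\<close>

text \<open>The finest splitting of a block list with the same total weight; merging undoes
  it.\<close>

definition expand :: "(nat \<times> nat) list \<Rightarrow> (nat \<times> nat) list" where
  "expand bl = concat (map (\<lambda>(h, m). replicate (Suc m) (h, 0)) bl)"

lemma weight_replicate [simp]: "weight (replicate k (h, m)) = k * Suc m"
  by (induction k) auto

lemma expand_simps [simp]:
  "expand [] = []" "expand ((h, m) # r) = (h, 0) # replicate m (h, 0) @ expand r"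
  by (auto simp: expand_def)

lemma weight_expand [simp]: "weight (expand bl) = weight bl"
  by (induction bl) auto

lemma fst_expand: "fst ` set (expand bl) = fst ` set bl"
proof (induction bl)
  case (Cons y bl)
  then show ?case by (cases y) (simp add: image_Un set_replicate_conv_if)
qed simp

lemma valid_append:
  "valid (u @ v) \<longleftrightarrow> valid u \<and> valid v \<and> (\<forall>x \<in> fst ` set u. \<forall>y \<in> fst ` set v. y \<le> x)"
  by (auto simp: valid_def sorted_wrt_append)

lemma valid_Cons: "valid (x # v) \<longleftrightarrow> fst x \<le> 1 \<and> valid v \<and> (\<forall>y \<in> fst ` set v. y \<le> fst x)"
  by (auto simp: valid_def)

lemma valid_replicate: "fst x \<le> 1 \<Longrightarrow> valid (replicate k x)"
  by (induction k) (auto simp: valid_Cons, simp add: valid_def)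

lemma valid_expand: "valid (u @ expand bl) \<longleftrightarrow> valid (u @ bl)"
proof -
  have "valid (expand bl) \<longleftrightarrow> valid bl"
  proof (induction bl)
    case (Cons y bl)
    then show ?case
      by (cases y) (auto simp: valid_Cons valid_append valid_replicate fst_expand image_Un)
  qed simp
  then show ?thesis by (simp add: valid_append fst_expand)
qed

lemma expand_path:
  assumes "valid (u @ bl)" "n = weight (u @ bl) + 2"
  shows "(path_of (u @ expand bl), path_of (u @ bl)) \<in> (dexter_edges n)\<^sup>*"
  using assms
proof (induction bl arbitrary: u)
  case (Cons y bl)
  obtain h m where y: "y = (h, m)" by (cases y)
  have "(path_of (u @ (h, 0) # replicate m (h, 0) @ expand bl),
      path_of (u @ (h, 0 + weight (replicate m (h, 0))) # expand bl)) \<in> (dexter_edges n)\<^sup>*"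
    by (rule merge_path) (use Cons.prems y valid_expand[of u "y # bl"] in auto)
  moreover have "(path_of ((u @ [y]) @ expand bl), path_of ((u @ [y]) @ bl)) \<in> (dexter_edges n)\<^sup>*"
    by (rule Cons.IH) (use Cons.prems in auto)
  ultimately show ?case using y by simp
qed simp

lemma valid_split:
  assumes "valid bl"
  obtains u v where "bl = u @ v" "\<forall>x \<in> set u. fst x = 1" "\<forall>x \<in> set v. fst x = 0"
proof -
  have "\<exists>u v. bl = u @ v \<and> (\<forall>x \<in> set u. fst x = 1) \<and> (\<forall>x \<in> set v. fst x = 0)"
    using assms
  proof (induction bl)
    case (Cons y bl)
    show ?case
    proof (cases "fst y = 1")
      case True
      with Cons obtain u v where "bl = u @ v" "\<forall>x \<in> set u. fst x = 1" "\<forall>x \<in> set v. fst x = 0"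
        by (auto simp: valid_def)
      with True show ?thesis by (intro exI[of _ "y # u"] exI[of _ v]) simp
    next
      case False
      with Cons.prems have "\<forall>x \<in> set (y # bl). fst x = 0" by (auto simp: valid_def)
      then show ?thesis by (metis append_Nil list.set(1) empty_iff)
    qed
  qed simp
  then show thesis using that by blast
qed

text \<open>The finest splitting of \<open>bl\<close> consists of blocks \<open>(1, 0)\<close>
  followed by blocks \<open>(0, 0)\<close>. It arises from the bottom by raising an initial segment,
  and merging then gives \<open>bl\<close>.\<close>

lemma bottom_path:
  assumes "valid bl" "weight bl = n"
  shows "(path_of (replicate n (0, 0)), path_of bl) \<in> (dexter_edges (n + 2))\<^sup>*"
proof -
  have "valid (expand bl)" using valid_expand[of "[]"] assms by simp
  then obtain u v where uv: "expand bl = u @ v" "\<forall>x \<in> set u. fst x = 1" "\<forall>x \<in> set v. fst x = 0"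
    using valid_split by blast
  have "\<forall>x \<in> set (expand bl). snd x = 0" by (auto simp: expand_def)
  with uv have "\<forall>x \<in> set u. x = (1, 0)" "\<forall>x \<in> set v. x = (0, 0)" by (simp_all add: prod_eq_iff)
  then have "u = replicate (length u) (1, 0)" "v = replicate (length v) (0, 0)"
    by (metis replicate_length_same)+
  then obtain j k where jk: "u = replicate j (1, 0)" "v = replicate k (0, 0)" by blast
  have n: "n = j + k" using uv(1) jk assms(2) by (metis weight_expand weight_simps(3) weight_replicate mult.right_neutral One_nat_def)
  have "(path_of (replicate n (0, 0)), path_of (expand bl)) \<in> (dexter_edges (n + 2))\<^sup>*"
    using raise_path[of "[]" "replicate j (0, 0)" v "n + 2"] uv(1) jk n by (simp add: replicate_add)
  also have "(path_of (expand bl), path_of bl) \<in> (dexter_edges (n + 2))\<^sup>*"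
    using expand_path[of "[]" bl "n + 2"] assms by simp
  finally show ?thesis .
qed

text \<open>Raising all blocks of height 0 makes the heights equal, so that everything merges into
  one block.\<close>

lemma top_path:
  assumes "valid bl" "weight bl = n" "n \<ge> 1"
  shows "(path_of bl, path_of [(1, n - 1)]) \<in> (dexter_edges (n + 2))\<^sup>*"
proof -
  obtain u v where uv: "bl = u @ v" "\<forall>x \<in> set u. fst x = 1" "\<forall>x \<in> set v. fst x = 0"
    using valid_split assms(1) by blast
  define c where "c = u @ map (\<lambda>(h, m). (1::nat, m)) v"
  have "weight (map (\<lambda>(h, m). (1, m)) v) = weight v" by (induction v) auto
  then have wc: "weight c = n" using assms uv c_def by simp
  have c1: "\<forall>x \<in> set c. fst x = 1" using uv by (auto simp: c_def)
  have "(path_of bl, path_of c) \<in> (dexter_edges (n + 2))\<^sup>*"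
    using raise_path[of u v "[]" "n + 2"] uv assms by (simp add: c_def)
  moreover obtain y c' where c: "c = y # c'" using wc assms(3) by (cases c) auto
  then obtain k where y: "y = (1, k)" using c1 by (cases y) auto
  have "valid c" using c1 valid_ones_zeros[of c "[]"] by simp
  then have "(path_of c, path_of [(1, k + weight c')]) \<in> (dexter_edges (n + 2))\<^sup>*"
    using merge_path[of "[]" 1 k c' "[]" "n + 2"] c c1 y wc by simp
  moreover have "k + weight c' = n - 1" using wc c y by simp
  ultimately show ?thesis by simp
qed

section \<open>Parsing regular paths and the interval F_n\<close>

text \<open>The first block is read off from the first run of ones, the zeros after it and the next
  1. The prefix \<open>0 # 1\<close> in the last assumption stands for the valley before
  \<open>s\<close>.\<close>

lemma regular_parse:
  assumes "set s \<subseteq> {0, 1}" "int p + 1 + height s = 0"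
    "\<forall>y \<in> set (valleys (int p + 1) s). 0 \<le> y \<and> y \<le> 1" "last_run_single (0 # 1 # s)"
  shows "\<exists>bl. s = blocks_tail p bl \<and> map (int \<circ> fst) bl = valleys (int p + 1) s"
  using assms
proof (induction "length s" arbitrary: s p rule: less_induct)
  case less
  define m where "m = length (takeWhile (\<lambda>c. c = 1) s)"
  define t where "t = dropWhile (\<lambda>c. c = 1) s"
  define c where "c = length (takeWhile (\<lambda>c. c = 0) t)"
  define r where "r = dropWhile (\<lambda>c. c = 0) t"
  have tw: "takeWhile (\<lambda>c. c = d) l = replicate (length (takeWhile (\<lambda>c. c = d) l)) d"
    for d :: nat and l by (rule replicate_length_same[symmetric]) (auto dest: set_takeWhileD)
  have st: "s = replicate m 1 @ t" unfolding m_def t_def by (simp flip: tw)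
  have tr: "t = replicate c 0 @ r" unfolding c_def r_def by (simp flip: tw)
  have t1: "t = [] \<or> hd t \<noteq> 1" using hd_dropWhile[of "\<lambda>c. c = 1" s] unfolding t_def by blast
  have r0: "r = [] \<or> hd r \<noteq> 0" using hd_dropWhile[of "\<lambda>c. c = 0" t] unfolding r_def by blast
  show ?case
  proof (cases r)
    case Nil
    \<comment> \<open>The 1 before \<open>s\<close> belongs to the last run, which has
      \<open>Suc m\<close> ones; the final height then gives \<open>p + 1\<close> zeros.\<close>
    have "last_run_single ([0] @ replicate (Suc m) 1 @ replicate c 0)"
      using less.prems(4) st tr Nil by simp
    from last_run_single_run[OF this] have "m = 0" by simp
    moreover from this have "c = p + 1" using less.prems(2) st tr Nil by simp
    ultimately have "s = replicate (p + 1) 0" using st tr Nil by simp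
    then show ?thesis by (intro exI[of _ "[]"]) (simp del: replicate.simps)
  next
    case (Cons d s')
    with r0 less.prems(1) st tr have d: "d = 1" by auto
    with t1 tr Cons obtain c' where c: "c = Suc c'" by (cases c) auto
    have s: "s = replicate m 1 @ replicate c 0 @ 1 # s'" using st tr Cons d by simp
    define h where "h = int p + 1 + int m - int c"
    have vs: "valleys (int p + 1) s = h # valleys (h + 1) s'"
      unfolding s h_def using last_replicate[of c 0] c
      by (auto simp: valleys_append algebra_simps simp del: replicate.simps(2))
    then have h: "0 \<le> h" "h \<le> 1" using less.prems(3) by auto
    have "0 # 1 # s = (0 # 1 # replicate m 1 @ replicate c' 0) @ 0 # 1 # s'"
      unfolding s c by (simp add: replicate_app_Cons_same)
    then have "last_run_single (0 # 1 # s')"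
      using less.prems(4) last_run_single_suffix by metis
    moreover have "int (nat h) + 1 + height s' = 0" using less.prems(2) h unfolding s h_def by simp
    ultimately obtain bl where bl: "s' = blocks_tail (nat h) bl"
      "map (int \<circ> fst) bl = valleys (int (nat h) + 1) s'"
      using less.hyps[of s' "nat h"] less.prems(1,3) vs h unfolding s by auto
    have "c = p + 1 + m - nat h" using h unfolding h_def by linarith
    then show ?thesis using bl vs h s by (intro exI[of _ "(nat h, m) # bl"]) simp
  qed
qed

text \<open>The letter after \<open>a\<close> in \<open>w\<close> is 0, so both leading ones belong
  to \<open>a\<close>, which the move keeps.\<close>

lemma starts_11_edge:
  assumes "(w, v) \<in> dexter_edges n" "take 2 w = [1, 1]"
  shows "take 2 v = [1, 1]"
proof -
  obtain a N x b i where w: "w \<in> dyck_paths n" and mov: "movable w a N x b"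
    and i: "1 \<le> i" "i \<le> N" and v: "v = a @ replicate (N - i) 0 @ x @ replicate i 0 @ b"
    using assms(1) unfolding dexter_edges_def by blast
  have weq: "w = a @ replicate N 0 @ x @ b" "N \<ge> 1" using mov by (auto simp: movable_def)
  then obtain N' where "w = a @ 0 # replicate N' 0 @ x @ b" by (cases N) auto
  then have "length a \<ge> 2" "take 2 w = take 2 a" using assms(2)
    by (cases a; cases "tl a"; auto)+
  then show ?thesis using assms(2) v by simp
qed

lemma bottom_eq: "[1, 1, 0, 0] @ concat (replicate n [1, 0]) = path_of (replicate n (0, 0))"
proof -
  have "blocks_tail 0 (replicate n (0, 0)) = 0 # concat (replicate n [1, 0])"
    by (induction n) auto
  then show ?thesis by (cases n) (auto simp: path_of_def numeral_2_eq_2)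
qed

lemma top_eq: "n \<ge> 1 \<Longrightarrow> [1] @ replicate n 1 @ replicate n 0 @ [1, 0, 0] = path_of [(1, n - 1)]"
  by (cases n) (auto simp: path_of_def numeral_2_eq_2)

text \<open>Regularity is pulled back from the top element, and the initial letters 1 1 are carried
  forward from the bottom element; \<open>regular_parse\<close> then yields the block list.\<close>

lemma F_eq:
  assumes "n \<ge> 1"
  shows "F n = path_of ` {bl. valid bl \<and> weight bl = n}"
proof (intro equalityI subsetI)
  fix w assume "w \<in> path_of ` {bl. valid bl \<and> weight bl = n}"
  then obtain bl where bl: "w = path_of bl" "valid bl" "weight bl = n" by blast
  have "valid (replicate n (0, 0))" "valid [(1, n - 1)]"
    using valid_replicate[of "(0, 0)" n] by (auto simp: valid_def)
  then show "w \<in> F n"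
    using bl bottom_path[OF bl(2,3)] top_path[OF bl(2,3) assms] path_of_dyck[of bl] assms
      path_of_dyck[of "replicate n (0, 0)"] path_of_dyck[of "[(1, n - 1)]"]
    unfolding F_def dexter_le_def bottom_eq top_eq[OF assms] by simp
next
  fix w assume w: "w \<in> F n"
  let ?top = "path_of [(1, n - 1)]"
  have dyck: "w \<in> dyck_paths (n + 2)"
    and lo: "(path_of (replicate n (0, 0)), w) \<in> (dexter_edges (n + 2))\<^sup>*"
    and hi: "(w, ?top) \<in> (dexter_edges (n + 2))\<^sup>*"
    using w unfolding F_def dexter_le_def bottom_eq top_eq[OF assms] by auto
  have "regular ?top"
    unfolding regular_def
  proof
    show "sorted_wrt (\<ge>) (1 # valleys 0 ?top)"
      unfolding path_of_def using assms
      by (cases n) (auto simp: valleys_append numeral_2_eq_2 simp flip: replicate_Suc)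
    show "last_run_single ?top"
      unfolding path_of_def last_run_single_def using assms
      by (intro exI[of _ "1 # 1 # replicate (n - 1) 1 @ replicate (n - 1) 0"] exI[of _ 2])
        (cases n; auto simp: numeral_2_eq_2 replicate_app_Cons_same)
  qed
  with hi have reg: "regular w"
    by (induction rule: converse_rtrancl_induct) (auto intro: regular_edge_source)
  have "take 2 w = [1, 1]"
    using lo
  proof (induction rule: rtrancl_induct)
    case base
    show ?case by (simp add: path_of_def)
  next
    case (step y z)
    then show ?case using starts_11_edge by blast
  qed
  then obtain s where s: "w = 1 # 1 # s" by (cases w; cases "tl w"; auto)
  \<comment> \<open>The displayed 0 is not among the two leading ones, so these belong to
    \<open>p\<close>.\<close>
  obtain p j where pj: "1 # 1 # s = p @ 0 # 1 # replicate j 0"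
    using reg s by (auto simp: regular_def last_run_single_def)
  then obtain p' where "s = p' @ 0 # 1 # replicate j 0" by (cases p; cases "tl p"; auto)
  then have lrs: "last_run_single (0 # 1 # s)"
    unfolding last_run_single_def by (metis append_Cons)
  have v: "valleys 0 w = valleys (int 1 + 1) s" unfolding s by simp
  have "\<exists>bl. s = blocks_tail 1 bl \<and> map (int \<circ> fst) bl = valleys (int 1 + 1) s"
  proof (rule regular_parse)
    show "\<forall>y\<in>set (valleys (int 1 + 1) s). 0 \<le> y \<and> y \<le> 1"
      using reg dyck valleys_nonneg[of 0 w] unfolding v[symmetric] regular_def
      by (auto simp: dyck_paths_iff)
  qed (use lrs dyck s in \<open>auto simp: dyck_paths_iff\<close>)
  then obtain bl where bl: "s = blocks_tail 1 bl" "map (int \<circ> fst) bl = valleys (int 1 + 1) s"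
    by blast
  have "valid bl"
    using reg unfolding valid_def regular_def v bl(2)[symmetric] by (auto simp: sorted_wrt_map)
  moreover have w: "w = path_of bl" using s bl(1) by (simp add: path_of_def)
  ultimately have "weight bl = n" using dyck path_of_dyck[of bl] by (simp add: dyck_paths_iff)
  then show "w \<in> path_of ` {bl. valid bl \<and> weight bl = n}" using w \<open>valid bl\<close> by blast
qed

section \<open>Computing rho on block lists\<close>

text \<open>The reading process by recursion on the rest of the word, with the height
  \<open>h\<close> before it in place of a position.\<close>

fun scan :: "int \<Rightarrow> nat list \<Rightarrow> nat \<times> nat list \<Rightarrow> nat \<times> nat list" where
  "scan h (c # d # s) (k, cur) = scan (h + height [c]) (d # s)
     (if c = 1 \<and> d = 1 then (k + 1, cur)
      else if c = 0 \<and> d = 1 then (0, cur @ [nat (h + height [c])] @ replicate k 2)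
      else (k, cur))"
| "scan h s st = st"

lemma fold_rho_step:
  "fold (rho_step (p @ s)) [length p..<length (p @ s) - 1] st = scan (height p) s st"
proof (induction "height p" s st arbitrary: p rule: scan.induct)
  case (1 c d s k cur)
  have step: "rho_step (p @ c # d # s) (length p) (k, cur) =
     (if c = 1 \<and> d = 1 then (k + 1, cur)
      else if c = 0 \<and> d = 1 then (0, cur @ [nat (height p + height [c])] @ replicate k 2)
      else (k, cur))"
    by (simp add: rho_step_def nth_append)
  have "[length p..<length (p @ c # d # s) - 1] =
      length p # [length (p @ [c])..<length ((p @ [c]) @ d # s) - 1]"
    using upt_conv_Cons[of "length p" "length (p @ c # d # s) - 1"] by (simp del: upt_Suc)
  then show ?case using "1"[of "p @ [c]"] step by simp
qed auto

lemma scan_ones: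
  "scan h (1 # replicate m 1 @ s) (k, cur) = scan (h + int m) (1 # s) (k + m, cur)"
proof (induction m arbitrary: h k)
  case (Suc m)
  show ?case using Suc.IH[of "h + 1" "k + 1"] by (simp add: algebra_simps)
qed simp

lemma scan_zeros:
  "scan h (replicate (Suc c) 0 @ 1 # s) (k, cur) =
     scan (h - int (Suc c)) (1 # s) (0, cur @ nat (h - int (Suc c)) # replicate k 2)"
  by (induction c arbitrary: h) (auto simp: algebra_simps)

lemma scan_final: "scan h (replicate c 0) st = st"
  by (cases st) (induction c arbitrary: h rule: induct_nat_012; simp)

text \<open>The 1 after the previous valley stays in front, so \<open>m\<close> further ones give
  exactly \<open>m\<close> overlapping pairs 1 1, hence \<open>m\<close> twos after the next
  height.\<close>

lemma scan_blocks_tail: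
  assumes "sorted_wrt (\<ge>) (p # map fst bl)"
  shows "snd (scan (int p) (1 # blocks_tail p bl) (0, cur)) = cur @ word_of bl"
  using assms
proof (induction p bl arbitrary: cur rule: blocks_tail.induct)
  case (1 p)
  then show ?case using scan_final[of _ "Suc p"] by simp
next
  case (2 p h m r)
  have h: "h \<le> p" using 2 by auto
  then obtain c where c: "p + 1 + m - h = Suc c" by (metis Suc_diff_le add.commute add.assoc plus_1_eq_Suc trans_le_add2)
  have "scan (int p) (1 # blocks_tail p ((h, m) # r)) (0, cur) =
      scan (int p + int m) (1 # replicate (Suc c) 0 @ 1 # blocks_tail h r) (m, cur)"
    using c scan_ones[of "int p" m _ 0 cur] by simp
  also have "\<dots> = scan (int p + int m + 1) (replicate (Suc c) 0 @ 1 # blocks_tail h r) (m, cur)"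
    by simp
  also have "\<dots> = scan (int h) (1 # blocks_tail h r) (0, cur @ h # replicate m 2)"
  proof -
    have "int p + int m + 1 - int (Suc c) = int h" using c by linarith
    then show ?thesis by (simp only: scan_zeros nat_int)
  qed
  finally show ?case using 2 by simp
qed

text \<open>The reading starts after the first letter, at height 1, as if a valley of height 1 had
  just been passed.\<close>

lemma rho_path_of: "valid bl \<Longrightarrow> rho (path_of bl) = word_of bl"
  using scan_blocks_tail[of 1 bl "[]"]
    fold_rho_step[of "[1]" "1 # blocks_tail 1 bl" "(0, [])"]
  by (simp add: rho_def path_of_def valid_def)

section \<open>The sets Z_n as sets of admissible words\<close>

text \<open>Closed form of the recursion: among the words of length \<open>n\<close>, these form
  \<open>Z n\<close>, those starting with 1 form \<open>Z1 n\<close>, and those of the latter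
  without 0 form \<open>Zb n\<close>.\<close>

definition admissible :: "nat list \<Rightarrow> bool" where
  "admissible z \<longleftrightarrow> z \<noteq> [] \<and> hd z \<in> {0, 1} \<and> set z \<subseteq> {0, 1, 2} \<and>
     sorted_wrt (\<lambda>a b. \<not> (a = 0 \<and> b = 1)) z"

lemma admissible_Cons:
  "admissible (c # t) \<longleftrightarrow> c \<in> {0, 1} \<and> set t \<subseteq> {0, 1, 2} \<and> (c = 0 \<longrightarrow> 1 \<notin> set t) \<and>
     sorted_wrt (\<lambda>a b. \<not> (a = 0 \<and> b = 1)) t"
  by (auto simp: admissible_def)

lemma admissible_no_zero:
  "0 \<notin> set z \<Longrightarrow> sorted_wrt (\<lambda>a b. \<not> (a = (0::nat) \<and> b = (1::nat))) z"
  by (induction z) auto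

lemma Zb_eq: "Zb n = {z. length z = n \<and> z \<noteq> [] \<and> hd z = 1 \<and> set z \<subseteq> {1, 2}}"
proof (induction n rule: Zb.induct)
  case 2
  show ?case by (auto simp: length_Suc_conv)
next
  case (3 n)
  show ?case
  proof (rule set_eqI)
    fix z
    show "z \<in> Zb (Suc (Suc n)) \<longleftrightarrow>
      z \<in> {z. length z = Suc (Suc n) \<and> z \<noteq> [] \<and> hd z = 1 \<and> set z \<subseteq> {1, 2}}"
    proof (cases z rule: rev_cases)
      case (snoc y c)
      then have "z \<in> Zb (Suc (Suc n)) \<longleftrightarrow> c \<in> {1, 2} \<and> y \<in> Zb (Suc n)" by auto
      then show ?thesis unfolding 3 using snoc by (cases y) auto
    qed auto
  qed
qed auto

lemma admissible_snoc:
  assumes "y \<noteq> []"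
  shows "admissible (y @ [c]) \<longleftrightarrow> admissible y \<and> c \<in> {0, 1, 2} \<and> (c = 1 \<longrightarrow> 0 \<notin> set y)"
  using assms unfolding admissible_def by (auto simp: sorted_wrt_append)

lemma admissible_no_zero_iff:
  "y \<noteq> [] \<and> hd y = 1 \<and> set y \<subseteq> {1, 2} \<longleftrightarrow> admissible y \<and> hd y = 1 \<and> 0 \<notin> set y"
  using admissible_no_zero[of y] unfolding admissible_def by (cases "0 \<in> set y") auto

text \<open>The recursion appends letters, so words are split at their last letter. A final 1 must
  not come after a 0, which is why it is appended only to words of \<open>Zb\<close>.\<close>

lemma Z1_eq: "Z1 n = {z. length z = n \<and> admissible z \<and> hd z = 1}"
proof (induction n rule: Z1.induct)
  case 2
  show ?case by (auto simp: length_Suc_conv admissible_def)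
next
  case (3 n)
  show ?case
  proof (rule set_eqI)
    fix z
    show "z \<in> Z1 (Suc (Suc n)) \<longleftrightarrow> z \<in> {z. length z = Suc (Suc n) \<and> admissible z \<and> hd z = 1}"
    proof (cases z rule: rev_cases)
      case (snoc y c)
      then have "z \<in> Z1 (Suc (Suc n)) \<longleftrightarrow>
          c \<in> {0, 2} \<and> y \<in> Z1 (Suc n) \<or> c = 1 \<and> y \<in> Zb (Suc n)" by auto
      then show ?thesis
        unfolding 3 Zb_eq admissible_no_zero_iff snoc
        using admissible_snoc[of y c] by (cases "y = []") (simp, auto)
    qed (auto simp: admissible_def)
  qed
qed (auto simp: admissible_def)

lemma Z0_eq: "Z0 n = {0 # t | t. 1 # t \<in> Z1 n \<and> 1 \<notin> set t}"
  by (cases n rule: Z0.cases) auto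

text \<open>An admissible word starting with 0 contains no 1; changing its first letter to 1 gives
  the word of \<open>Z1\<close> from which the rule for \<open>Z0\<close> produces it.\<close>

lemma Z_eq: "Z n = {z. length z = n \<and> admissible z}"
proof (intro equalityI subsetI)
  fix z assume "z \<in> Z n"
  then show "z \<in> {z. length z = n \<and> admissible z}"
    unfolding Z_def Z0_eq Z1_eq by (auto simp: admissible_Cons)
next
  fix z assume z: "z \<in> {z. length z = n \<and> admissible z}"
  then obtain c t where "z = c # t" by (cases z) (auto simp: admissible_def)
  with z show "z \<in> Z n" unfolding Z_def Z0_eq Z1_eq by (auto simp: admissible_Cons)
qed

lemma set_word_of: "fst ` set bl \<subseteq> set (word_of bl)" "set (word_of bl) \<subseteq> fst ` set bl \<union> {2}"
  by (induction bl) auto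

lemma valid_fst: "valid bl \<Longrightarrow> fst ` set bl \<subseteq> {0, 1}"
  by (induction bl) (auto simp: valid_Cons)

text \<open>Each block starts at a letter 0 or 1 and takes the twos that follow it. That no 1 comes
  after a 0 means that the block heights decrease weakly.\<close>

lemma admissible_word_of:
  "admissible z \<longleftrightarrow> (\<exists>bl. bl \<noteq> [] \<and> valid bl \<and> z = word_of bl)"
proof
  assume "\<exists>bl. bl \<noteq> [] \<and> valid bl \<and> z = word_of bl"
  then obtain bl where bl: "bl \<noteq> []" "valid bl" "z = word_of bl" by blast
  have "sorted_wrt (\<lambda>a b. \<not> (a = 0 \<and> b = 1)) (word_of bl)"
    using bl(2)
  proof (induction bl)
    case (Cons y r)
    obtain h m where y: "y = (h, m)" by (cases y)
    have "1 \<notin> set (word_of r)" if "h = 0"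
    proof -
      have "1 \<notin> fst ` set r" using that Cons.prems y by (auto simp: valid_Cons)
      then show ?thesis using set_word_of(2)[of r] by auto
    qed
    moreover have "sorted_wrt (\<lambda>a b. \<not> (a = (0::nat) \<and> b = (1::nat))) (replicate m 2)"
      by (rule admissible_no_zero) auto
    ultimately show ?case using Cons y
      by (auto simp: valid_Cons sorted_wrt_append)
  qed simp
  moreover obtain h m r where "bl = (h, m) # r" using bl(1) by (cases bl) auto
  then have "hd z \<in> {0, 1}" "z \<noteq> []" using bl(2,3) by (auto simp: valid_Cons)
  moreover have "set z \<subseteq> fst ` set bl \<union> {2}" using set_word_of(2) bl(3) by simp
  then have "set z \<subseteq> {0, 1} \<union> {2}" using valid_fst[OF bl(2)] by (meson Un_mono order_refl order_trans)
  then have "set z \<subseteq> {0, 1, 2}" by auto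
  ultimately show "admissible z" using bl(3) by (simp add: admissible_def)
next
  assume "admissible z"
  then show "\<exists>bl. bl \<noteq> [] \<and> valid bl \<and> z = word_of bl"
  proof (induction z rule: rev_induct)
    case (snoc c y)
    show ?case
    proof (cases "y = []")
      case True
      with snoc.prems show ?thesis
        by (intro exI[of _ "[(c, 0)]"]) (auto simp: admissible_def valid_def)
    next
      case False
      with snoc.prems have y: "admissible y" "c \<in> {0, 1, 2}" "c = 1 \<Longrightarrow> 0 \<notin> set y"
        using admissible_snoc[of y c] by auto
      then obtain bl where bl: "bl \<noteq> []" "valid bl" "y = word_of bl" using snoc.IH by blast
      show ?thesis
      \<comment> \<open>A final 2 enlarges the last block; a final 0 or 1 opens a new one.\<close>
      proof (cases "c = 2")
        case True
        obtain r h m where r: "bl = r @ [(h, m)]" using bl(1) by (metis rev_exhaust surj_pair)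
        have "y @ [c] = word_of (r @ [(h, Suc m)])"
          using bl(3) r True by (simp add: replicate_append_same)
        moreover have "valid (r @ [(h, Suc m)])" using bl(2) r by (simp add: valid_append valid_Cons)
        ultimately show ?thesis by blast
      next
        case False
        have "\<forall>x \<in> fst ` set bl. c \<le> x"
        proof
          fix x assume "x \<in> fst ` set bl"
          then have "x \<in> set y" using bl(3) set_word_of(1) by blast
          then have "c = 1 \<Longrightarrow> x \<noteq> 0" using y(3) by metis
          then show "c \<le> x" using y(2) False by auto
        qed
        moreover have "valid [(c, 0)]" using y(2) False by (auto simp: valid_def)
        ultimately have "valid (bl @ [(c, 0)])" using bl(2) by (simp add: valid_append)
        then show ?thesis using bl(3) by (intro exI[of _ "bl @ [(c, 0)]"]) simp
      qed
    qed
  qed (simp add: admissible_def)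
qed

lemma length_word_of: "length (word_of bl) = weight bl"
  by (induction bl) auto

theorem theorem9p17:
  fixes n :: nat
  assumes "n \<ge> 1"
  shows "rho ` F n = Z n"
proof -
  \<comment> \<open>The bound on \<open>n\<close> excludes the empty block list, as
    \<open>admissible_word_of\<close> requires.\<close>
  have "bl \<noteq> []" if "weight bl = n" for bl using that assms by auto
  then have "Z n = word_of ` {bl. valid bl \<and> weight bl = n}"
    unfolding Z_eq admissible_word_of using length_word_of by auto
  also have "\<dots> = rho ` path_of ` {bl. valid bl \<and> weight bl = n}"
    by (auto simp: rho_path_of image_image)
  finally show ?thesis using F_eq[OF assms] by simp
qed

end
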